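(* Let $\mathcal{M}$ be a Riemannian homogeneous space with isometry group $G = I(\mathcal{M})$ acting transitively on it, and let $X$ be either $\mathcal{M}$ or $G$. Let $f \in L^2(X,\mathbf{R})$ and let $w_2 : X\times X\to\mathbf{R}$ be a separable second order kernel, i.e. $w_2(x,y) = \tilde{w}_2(x)\,\bar{w}_2(y)$ with $\tilde{w}_2,\bar{w}_2\in L^2(X,\mathbf{R})$. Then for every $g\in G$, $$(f\star_2 w_2)(g) = \big((f\star\tilde{w}_2)(g)\big)\,\big((f\star\bar{w}_2)(g)\big).$$
   Context: Standing assumptions: $\mathcal{M}$ is a Riemannian manifold on which its isometry group $G = I(\mathcal{M})$ acts transitively (a Riemannian homogeneous space), and $G$ is a locally compact topological group. $\omega^{\mathcal{M}}$ denotes the Riemannian volume of $\mathcal{M}$ (which is invariant under $G$), and $\mu_G$ the (left) Haar measure on $G$. $L^2(\mathcal{M},\mathbf{R})$ and $L^2(G,\mathbf{R})$ are the spaces of real-valued square-integrable functions with respect to these measures. Action on functions: for $X = \mathcal{M}$ or $X = G$ (with $G$ acting on itself by left multiplication), $g\in G$ and $h : X \to \mathbf{R}$, set $(g\cdot h)(x) = h(g^{-1}\cdot x)$; for $w : X^2 \to \mathbf{R}$, set $(g\cdot w)(x_1,x_2) = w(g^{-1}\cdot x_1,g^{-1}\cdot x_2)$. Write $\nu = \omega^{\mathcal{M}}$ if $X=\mathcal{M}$ and $\nu=\mu_G$ if $X = G$. For $f, w : X\to\mathbf{R}$, the correlation $f\star w : G\to\mathbf{R}$ is $(f\star w)(g)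 = \int_X f(x)\,(g\cdot w)(x)\,\nu(x)$. For $f:X\to\mathbf{R}$ and $w_2:X^2\to\mathbf{R}$, the second order correlation $f\star_2 w_2 : G\to\mathbf{R}$ is $(f\star_2 w_2)(g) = \int_X\int_X f(x_1)f(x_2)\,(g\cdot w_2)(x_1,x_2)\,\nu(x_1)\,\nu(x_2)$. *)

theory Defs
  imports "HOL-Analysis.Analysis" "HOL-Algebra.Group"
begin

section \<open>Smooth maps between open subsets of normed spaces\<close>

text \<open>
  Both predicates are meant for open \<open>S\<close> in a finite-dimensional domain; there, requiring all
  directional derivatives to be \<open>k\<close> times continuously differentiable is the usual notion.
\<close>

primrec Ck_on :: "nat \<Rightarrow> 'a::real_normed_vector set \<Rightarrow> ('a \<Rightarrow> 'b::real_normed_vector) \<Rightarrow> bool" where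
  "Ck_on 0 S f \<longleftrightarrow> continuous_on S f"
| "Ck_on (Suc k) S f \<longleftrightarrow>
     (\<forall>x\<in>S. f differentiable (at x)) \<and> (\<forall>v. Ck_on k S (\<lambda>x. frechet_derivative f (at x) v))"

definition smooth_on :: "'a::real_normed_vector set \<Rightarrow> ('a \<Rightarrow> 'b::real_normed_vector) \<Rightarrow> bool" where
  "smooth_on S f \<longleftrightarrow> (\<forall>k. Ck_on k S f)"


section \<open>Riemannian manifolds\<close>

text \<open>
  The underlying topological space of an \<open>n\<close>-dimensional manifold is a type \<open>'m\<close>, Hausdorff and
  second countable, with \<open>n = CARD('n)\<close>. A chart is a pair of its domain and its coordinate map
  (irrelevant outside the domain). The atlas need not be maximal. The metric tensor is given by
  its components: \<open>metric M c p\<close> is the matrix \<open>(g_ij)\<close> at the point \<open>p\<close> in the coordinates \<open>c\<close>.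
\<close>

type_synonym ('m, 'n) chart = "'m set \<times> ('m \<Rightarrow> real^'n)"

record ('m, 'n) riemannian_structure =
  atlas :: "('m, 'n) chart set"
  metric :: "('m, 'n) chart \<Rightarrow> 'm \<Rightarrow> real^'n^'n"

abbreviation chart_inv :: "('m, 'n) chart \<Rightarrow> real^'n \<Rightarrow> 'm" where
  "chart_inv c \<equiv> inv_into (fst c) (snd c)"

definition is_chart :: "('m::topological_space, 'n::finite) chart \<Rightarrow> bool" where
  "is_chart c \<longleftrightarrow> open (fst c) \<and> open (snd c ` fst c) \<and>
     homeomorphism (fst c) (snd c ` fst c) (snd c) (chart_inv c)"

definition coord_rep :: "('m, 'n) chart \<Rightarrow> ('m, 'n) chart \<Rightarrow> ('m \<Rightarrow> 'm) \<Rightarrow> real^'n \<Rightarrow> real^'n" where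
  "coord_rep c d F = snd d \<circ> F \<circ> chart_inv c"

definition coord_dom :: "('m, 'n) chart \<Rightarrow> ('m, 'n) chart \<Rightarrow> ('m \<Rightarrow> 'm) \<Rightarrow> (real^'n) set" where
  "coord_dom c d F = snd c ` (fst c \<inter> F -` fst d)"

definition smooth_map ::
    "('m::topological_space, 'n::finite) riemannian_structure \<Rightarrow> ('m \<Rightarrow> 'm) \<Rightarrow> bool" where
  "smooth_map M F \<longleftrightarrow> continuous_on UNIV F \<and>
     (\<forall>c\<in>atlas M. \<forall>d\<in>atlas M. smooth_on (coord_dom c d F) (coord_rep c d F))"

text \<open>The pullback of the metric along \<open>F\<close> is the metric.\<close>

definition preserves_metric ::
    "('m, 'n::finite) riemannian_structure \<Rightarrow> ('m \<Rightarrow> 'm) \<Rightarrow> bool" where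
  "preserves_metric M F \<longleftrightarrow>
     (\<forall>c\<in>atlas M. \<forall>d\<in>atlas M. \<forall>p\<in>fst c \<inter> F -` fst d.
        let J = jacobian (coord_rep c d F) (at (snd c p))
        in metric M c p = transpose J ** metric M d (F p) ** J)"

text \<open>
  For \<open>F = id\<close>, \<open>smooth_map\<close> says that the transition maps are smooth, and \<open>preserves_metric\<close> is
  the transformation law of a covariant 2-tensor under change of coordinates.
\<close>

definition riemannian_manifold ::
    "('m::{t2_space,second_countable_topology}, 'n::finite) riemannian_structure \<Rightarrow> bool" where
  "riemannian_manifold M \<longleftrightarrow>
     (\<forall>c\<in>atlas M. is_chart c) \<and>
     (\<Union>c\<in>atlas M. fst c) = UNIV \<and>
     smooth_map M id \<and>
     (\<forall>c\<in>atlas M. smooth_on (snd c ` fst c) (\<lambda>x. metric M c (chart_inv c x))) \<and>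
     (\<forall>c\<in>atlas M. \<forall>p\<in>fst c. transpose (metric M c p) = metric M c p \<and>
        (\<forall>v. v \<noteq> 0 \<longrightarrow> v \<bullet> (metric M c p *v v) > 0)) \<and>
     preserves_metric M id"

text \<open>The Riemannian volume is \<open>sqrt (det (g_ij)) dx\<close> in each chart; this determines it.\<close>

definition is_riemannian_volume ::
    "('m::topological_space, 'n::finite) riemannian_structure \<Rightarrow> 'm measure \<Rightarrow> bool" where
  "is_riemannian_volume M vol \<longleftrightarrow> sets vol = sets borel \<and>
     (\<forall>c\<in>atlas M. \<forall>A\<in>sets borel. A \<subseteq> fst c \<longrightarrow>
        emeasure vol A =
          (\<integral>\<^sup>+x\<in>snd c ` A. ennreal (sqrt (det (metric M c (chart_inv c x)))) \<partial>lborel))"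


section \<open>The isometry group\<close>

definition is_isometry ::
    "('m::topological_space, 'n::finite) riemannian_structure \<Rightarrow> ('m \<Rightarrow> 'm) \<Rightarrow> bool" where
  "is_isometry M F \<longleftrightarrow> bij F \<and> smooth_map M F \<and> smooth_map M (inv_into UNIV F) \<and> preserves_metric M F"

definition isometry_group ::
    "('m::topological_space, 'n::finite) riemannian_structure \<Rightarrow> ('m \<Rightarrow> 'm) monoid" where
  "isometry_group M = \<lparr>carrier = {F. is_isometry M F}, mult = (\<circ>), one = id\<rparr>"

text \<open>The compact-open topology. Its underlying set is \<open>H\<close>, as one sees from \<open>K = {}\<close>.\<close>

definition compact_open_topology ::
    "('a::topological_space \<Rightarrow> 'b::topological_space) set \<Rightarrow> ('a \<Rightarrow> 'b) topology" where
  "compact_open_topology H =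
     topology_generated_by {{F\<in>H. F ` K \<subseteq> U} | K U. compact K \<and> open U}"

definition topological_group :: "('g, 'b) monoid_scheme \<Rightarrow> 'g topology \<Rightarrow> bool" where
  "topological_group G T \<longleftrightarrow> group G \<and> topspace T = carrier G \<and>
     continuous_map (prod_topology T T) T (\<lambda>(g, h). g \<otimes>\<^bsub>G\<^esub> h) \<and>
     continuous_map T T (\<lambda>g. inv\<^bsub>G\<^esub> g)"

definition riemannian_homogeneous_space ::
    "('m::{t2_space,second_countable_topology}, 'n::finite) riemannian_structure \<Rightarrow> bool" where
  "riemannian_homogeneous_space M \<longleftrightarrow> riemannian_manifold M \<and>
     (\<forall>x y. \<exists>g\<in>carrier (isometry_group M). g x = y)"

definition left_haar_measure ::
    "('g, 'b) monoid_scheme \<Rightarrow> 'g topology \<Rightarrow> 'g measure \<Rightarrow> bool" where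
  "left_haar_measure G T \<mu> \<longleftrightarrow>
     space \<mu> = carrier G \<and> sets \<mu> = sigma_sets (carrier G) {U. openin T U} \<and>
     (\<forall>g\<in>carrier G. \<forall>A\<in>sets \<mu>. emeasure \<mu> ((\<lambda>h. g \<otimes>\<^bsub>G\<^esub> h) ` A) = emeasure \<mu> A) \<and>
     (\<forall>K\<in>sets \<mu>. compactin T K \<longrightarrow> emeasure \<mu> K < \<infinity>) \<and>
     (\<forall>A\<in>sets \<mu>. emeasure \<mu> A = (INF U\<in>{U. openin T U \<and> A \<subseteq> U}. emeasure \<mu> U)) \<and>
     (\<forall>U. openin T U \<longrightarrow>
        emeasure \<mu> U = (SUP K\<in>{K \<in> sets \<mu>. compactin T K \<and> K \<subseteq> U}. emeasure \<mu> K)) \<and>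
     emeasure \<mu> (carrier G) \<noteq> 0"


section \<open>Correlations\<close>

text \<open>Functions rather than classes modulo null sets; measurability refers to \<open>sets \<nu>\<close>.\<close>

definition L2 :: "'x measure \<Rightarrow> ('x \<Rightarrow> real) set" where
  "L2 \<nu> = {f \<in> borel_measurable \<nu>. integrable \<nu> (\<lambda>x. (f x)\<^sup>2)}"

text \<open>Throughout, \<open>act g x\<close> is the action of the group \<open>G\<close> on the set \<open>X = space \<nu>\<close>.\<close>

definition translate ::
    "('g, 'b) monoid_scheme \<Rightarrow> ('g \<Rightarrow> 'x \<Rightarrow> 'x) \<Rightarrow> 'g \<Rightarrow> ('x \<Rightarrow> real) \<Rightarrow> 'x \<Rightarrow> real" where
  "translate G act g h = (\<lambda>x. h (act (inv\<^bsub>G\<^esub> g) x))"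

definition translate2 ::
    "('g, 'b) monoid_scheme \<Rightarrow> ('g \<Rightarrow> 'x \<Rightarrow> 'x) \<Rightarrow> 'g \<Rightarrow> ('x \<times> 'x \<Rightarrow> real) \<Rightarrow> 'x \<times> 'x \<Rightarrow> real" where
  "translate2 G act g w = (\<lambda>(x\<^sub>1, x\<^sub>2). w (act (inv\<^bsub>G\<^esub> g) x\<^sub>1, act (inv\<^bsub>G\<^esub> g) x\<^sub>2))"

definition correlation ::
    "('g, 'b) monoid_scheme \<Rightarrow> ('g \<Rightarrow> 'x \<Rightarrow> 'x) \<Rightarrow> 'x measure \<Rightarrow>
      ('x \<Rightarrow> real) \<Rightarrow> ('x \<Rightarrow> real) \<Rightarrow> 'g \<Rightarrow> real" where
  "correlation G act \<nu> f w g = (\<integral>x. f x * translate G act g w x \<partial>\<nu>)"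

definition correlation2 ::
    "('g, 'b) monoid_scheme \<Rightarrow> ('g \<Rightarrow> 'x \<Rightarrow> 'x) \<Rightarrow> 'x measure \<Rightarrow>
      ('x \<Rightarrow> real) \<Rightarrow> ('x \<times> 'x \<Rightarrow> real) \<Rightarrow> 'g \<Rightarrow> real" where
  "correlation2 G act \<nu> f w g =
     (\<integral>x\<^sub>2. (\<integral>x\<^sub>1. f x\<^sub>1 * f x\<^sub>2 * translate2 G act g w (x\<^sub>1, x\<^sub>2) \<partial>\<nu>) \<partial>\<nu>)"

definition separable_kernel ::
    "'x measure \<Rightarrow> ('x \<times> 'x \<Rightarrow> real) \<Rightarrow> ('x \<Rightarrow> real) \<Rightarrow> ('x \<Rightarrow> real) \<Rightarrow> bool" where
  "separable_kernel \<nu> w u v \<longleftrightarrow> u \<in> L2 \<nu> \<and> v \<in> L2 \<nu> \<and>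
     (\<forall>x\<in>space \<nu>. \<forall>y\<in>space \<nu>. w (x, y) = u x * v y)"

end

theory Submission
  imports Defs
begin

text \<open>
  \<open>correlation2\<close> is an iterated integral, and a Bochner integral that does not exist is 0, so constants
  can be pulled out of both integrals without any integrability argument.
\<close>

lemma correlation2_separable:
  assumes act: "\<And>x. x \<in> space \<nu> \<Longrightarrow> act (inv\<^bsub>G\<^esub> g) x \<in> space \<nu>"
    and w: "separable_kernel \<nu> w u v"
  shows "correlation2 G act \<nu> f w g = correlation G act \<nu> f u g * correlation G act \<nu> f v g"
proof -
  let ?u = "translate G act g u" and ?v = "translate G act g v"
  \<comment> \<open>The factorization of \<open>w\<close> is given on \<open>space \<nu>\<close>, so
    \<open>act\<close> is what lets it apply at the translated points. The regrouping puts all that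
    depends on the outer variable \<open>y\<close> in front.\<close>
  have "correlation2 G act \<nu> f w g = (\<integral>y. (\<integral>x. (f y * ?v y) * (f x * ?u x) \<partial>\<nu>) \<partial>\<nu>)"
    unfolding correlation2_def
    by (intro Bochner_Integration.integral_cong refl)
      (use w act in \<open>simp add: separable_kernel_def translate_def translate2_def\<close>)
  \<comment> \<open>The factor \<open>f y * ?v y\<close> leaves the inner integral; what remains
    there is free of \<open>y\<close> and leaves the outer one.\<close>
  also have "\<dots> = correlation G act \<nu> f u g * correlation G act \<nu> f v g"
    by (simp add: correlation_def)
  finally show ?thesis .
qed

theorem mainTheorem5:
  fixes M :: "('m::{t2_space,second_countable_topology}, 'n::finite) riemannian_structure"
    and G :: "('m \<Rightarrow> 'm) monoid" and T :: "('m \<Rightarrow> 'm) topology"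
    and vol :: "'m measure" and \<mu> :: "('m \<Rightarrow> 'm) measure"
  assumes "riemannian_homogeneous_space M"
    and "G = isometry_group M" and "T = compact_open_topology (carrier G)"
    and "topological_group G T" and "locally_compact_space T"
    and "is_riemannian_volume M vol"
    and "left_haar_measure G T \<mu>"
  shows "(\<forall>f w\<^sub>2 u v. f \<in> L2 vol \<and> separable_kernel vol w\<^sub>2 u v \<longrightarrow>
            (\<forall>g\<in>carrier G. correlation2 G (\<lambda>h x. h x) vol f w\<^sub>2 g =
               correlation G (\<lambda>h x. h x) vol f u g * correlation G (\<lambda>h x. h x) vol f v g))
       \<and> (\<forall>f w\<^sub>2 u v. f \<in> L2 \<mu> \<and> separable_kernel \<mu> w\<^sub>2 u v \<longrightarrow>
            (\<forall>g\<in>carrier G. correlation2 G (mult G) \<mu> f w\<^sub>2 g =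
               correlation G (mult G) \<mu> f u g * correlation G (mult G) \<mu> f v g))"
proof -
  have "group G" and "space \<mu> = carrier G"
    using assms(4,7) by (auto simp: topological_group_def left_haar_measure_def)
  \<comment> \<open>For X = G, translations stay in the space because a group is closed under
    inverse and product.\<close>
  then have left_mult: "inv\<^bsub>G\<^esub> g \<otimes>\<^bsub>G\<^esub> h \<in> space \<mu>" if "g \<in> carrier G" "h \<in> space \<mu>" for g h
    using that by (simp add: group.is_monoid monoid.m_closed)
  \<comment> \<open>For X = M, having the Borel sets forces the space to be the whole type, so every
    map preserves it.\<close>
  have "sets vol = sets borel"
    using assms(6) by (simp add: is_riemannian_volume_def)
  then have "space vol = UNIV"
    by (auto dest: sets_eq_imp_space_eq)
  \<comment> \<open>The two conjuncts instantiate \<open>act\<close> with evaluation of isometries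
    and with left multiplication.\<close>
  then show ?thesis
    by (auto intro!: correlation2_separable left_mult)
qed

end
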